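(* If $\mathrm{lfp}\,\Phi = \mathrm{gfp}\,\Phi$ (i.e., $\Phi$ has exactly one fixed point), then for every $f \in E$, $\mathrm{lfp}\,\Phi \sqsubseteq f$ implies that there exists an ordinal $\lambda$ such that $\Phi(\Psi_f^{\lfloor \lambda \rfloor}(f)) \sqsubseteq f$ (i.e., $f$ is $(\lambda+1)$-inductive).
   Context: $(E, \sqsubseteq)$ is a complete lattice (every subset has a greatest lower bound/meet and a least upper bound/join; binary meet written $\sqcap$), and $\Phi\colon E \to E$ is a monotonic operator with least fixed point $\mathrm{lfp}\,\Phi$ and greatest fixed point $\mathrm{gfp}\,\Phi$. For $f \in E$, the $\kappa$-induction operator is $\Psi_f\colon E \to E$, $g \mapsto \Phi(g) \sqcap f$. The lower $\delta$-fold iteration is defined by transfinite recursion: $\Psi_f^{\lfloor 0 \rfloor}(g) = g$; $\Psi_f^{\lfloor \gamma+1 \rfloor}(g) = \Psi_f(\Psi_f^{\lfloor \gamma \rfloor}(g))$; and for a limit ordinal $\delta$, $\Psi_f^{\lfloor \delta \rfloor}(g)$ is the greatest lower bound (meet) of $\{\Psi_f^{\lfloor \gamma \rfloor}(g) \mid \gamma < \delta\}$. An element $f$ is called $(\lambda+1)$-inductive if $\Phi(\Psi_f^{\lfloor \lambda \rfloor}(f)) \sqsubseteq f$. All ordinals are tacitly assumed smaller than a fixed ambient ordinal $\nu$ (the smallest ordinal with $|\nu| > |E|$). *)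

theory Defs
  imports Main
begin

unbundle lattice_syntax and cardinal_syntax

text \<open>
  The type \<open>'a suc\<close> of HOL is the field of the cardinal successor of \<open>'a\<close>, an initial ordinal. With
  the order below its elements are thus the ordinals less than \<open>\<nu>\<close>, the least ordinal of cardinality
  greater than that of \<open>'a\<close> (also for finite \<open>'a\<close>, where \<open>\<nu>\<close> is the cardinality of \<open>'a\<close> plus one).
\<close>

lemma card_order_card_suc_UNIV: "card_order (card_suc |UNIV :: 'a set| )"
  by (rule card_order_card_suc) (rule card_of_card_order_on)

instantiation suc :: (type) wellorder
begin

definition less_eq_suc :: "'a suc \<Rightarrow> 'a suc \<Rightarrow> bool"
  where "x \<le> y \<longleftrightarrow> (x, y) \<in> card_suc |UNIV :: 'a set|"

definition less_suc :: "'a suc \<Rightarrow> 'a suc \<Rightarrow> bool"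
  where "x < y \<longleftrightarrow> x \<le> y \<and> x \<noteq> (y :: 'a suc)"

instance
proof -
  let ?r = "card_suc |UNIV :: 'a set|"
  have "Well_order ?r"
    using card_order_card_suc_UNIV card_order_on_Card_order card_order_on_well_order_on by blast
  then interpret wo_rel ?r
    by (rule wo_rel.intro)
  have refl: "x \<le> x" for x :: "'a suc"
    using REFL Field_card_suc[of "|UNIV :: 'a set|"]
    by (auto simp: refl_on_def less_eq_suc_def)
  have trans: "x \<le> y \<Longrightarrow> y \<le> z \<Longrightarrow> x \<le> z" for x y z :: "'a suc"
    unfolding less_eq_suc_def using TRANS by (rule transD)
  have antisym: "x \<le> y \<Longrightarrow> y \<le> x \<Longrightarrow> x = y" for x y :: "'a suc"
    unfolding less_eq_suc_def using ANTISYM by (rule antisymD)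
  have total: "x \<le> y \<or> y \<le> x" for x y :: "'a suc"
    unfolding less_eq_suc_def using TOTALS Field_card_suc[of "|UNIV :: 'a set|"] by blast
  have "?r - Id = {(x, y :: 'a suc). x < y}"
    by (auto simp: less_suc_def less_eq_suc_def)
  then have wf: "wf {(x, y :: 'a suc). x < y}"
    using WF by simp
  show "OFCLASS('a suc, wellorder_class)"
  proof
    fix x y z :: "'a suc" and P :: "'a suc \<Rightarrow> bool" and a :: "'a suc"
    show "x < y \<longleftrightarrow> x \<le> y \<and> \<not> y \<le> x"
      unfolding less_suc_def using antisym refl by blast
    show "x \<le> x" by (rule refl)
    show "x \<le> y \<Longrightarrow> y \<le> z \<Longrightarrow> x \<le> z" by (rule trans)
    show "x \<le> y \<Longrightarrow> y \<le> x \<Longrightarrow> x = y" by (rule antisym)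
    show "x \<le> y \<or> y \<le> x" by (rule total)
    show "P a" if "\<And>x. (\<And>y. y < x \<Longrightarrow> P y) \<Longrightarrow> P x"
      by (rule wf_induct_rule[OF wf, of P]) (rule that, simp)
  qed
qed

end

text \<open>These two facts determine the ordinal represented by \<open>'a suc\<close>.\<close>

lemma card_of_UNIV_less_suc: "|UNIV :: 'a set| <o |UNIV :: 'a suc set|"
  using card_suc_greater[OF card_of_card_order_on] card_of_unique[OF card_order_card_suc_UNIV]
  by (rule ordLess_ordIso_trans)

lemma card_of_lessThan_suc: "|{..<x :: 'a suc}| \<le>o |UNIV :: 'a set|"
proof -
  let ?c = "|UNIV :: 'a set|" and ?r = "card_suc |UNIV :: 'a set|"
  have "{..<x} = underS ?r x"
    by (auto simp: underS_def less_suc_def less_eq_suc_def)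
  moreover have "|underS ?r x| <o ?r"
    by (rule card_of_underS)
      (use card_order_card_suc_UNIV card_order_on_Card_order Field_card_suc in \<open>blast+\<close>)
  moreover have "?r =o cardSuc ?c"
    by (rule ordIso_symmetric, rule cardSuc_ordIso_card_suc, rule card_of_card_order_on)
  ultimately have "|{..<x}| <o cardSuc ?c"
    using ordLess_ordIso_trans by metis
  then show ?thesis
    using cardSuc_ordLeq_ordLess[OF card_of_Card_order card_of_Card_order] by blast
qed

definition is_successor :: "'i::wellorder \<Rightarrow> 'i \<Rightarrow> bool"
  where "is_successor \<gamma> \<delta> \<longleftrightarrow> \<gamma> < \<delta> \<and> (\<forall>\<eta>. \<gamma> < \<eta> \<longrightarrow> \<delta> \<le> \<eta>)"

lemma is_successor_less: "is_successor \<gamma> \<delta> \<Longrightarrow> \<gamma> < \<delta>"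
  by (simp add: is_successor_def)

lemma is_successor_unique: "is_successor \<gamma> \<delta> \<Longrightarrow> is_successor \<gamma>' \<delta> \<Longrightarrow> \<gamma> = \<gamma>'"
  unfolding is_successor_def by (metis linorder_neqE leD)

lemma the_is_successor: "is_successor \<gamma> \<delta> \<Longrightarrow> (THE \<gamma>. is_successor \<gamma> \<delta>) = \<gamma>"
  using is_successor_unique by blast

definition kappa_op :: "('a::complete_lattice \<Rightarrow> 'a) \<Rightarrow> 'a \<Rightarrow> 'a \<Rightarrow> 'a"
  where "kappa_op \<Phi> f g = \<Phi> g \<sqinter> f"

function lower_iter :: "('a::complete_lattice \<Rightarrow> 'a) \<Rightarrow> 'i::wellorder \<Rightarrow> 'a \<Rightarrow> 'a"
  where "lower_iter \<Psi> \<delta> g =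
    (if \<forall>\<gamma>. \<delta> \<le> \<gamma> then g
     else if \<exists>\<gamma>. is_successor \<gamma> \<delta> then \<Psi> (lower_iter \<Psi> (THE \<gamma>. is_successor \<gamma> \<delta>) g)
     else (\<Sqinter>\<gamma>\<in>{..<\<delta>}. lower_iter \<Psi> \<gamma> g))"
  by auto
termination
  by (relation "inv_image {(x, y). x < y} (\<lambda>(\<Psi>, \<delta>, g). \<delta>)")
    (auto simp: wf the_is_successor dest: is_successor_less)

declare lower_iter.simps [simp del]

lemma lower_iter_zero: "(\<And>\<gamma>. \<delta> \<le> \<gamma>) \<Longrightarrow> lower_iter \<Psi> \<delta> g = g"
  by (subst lower_iter.simps) simp

lemma lower_iter_successor:
  assumes "is_successor \<gamma> \<delta>"
  shows "lower_iter \<Psi> \<delta> g = \<Psi> (lower_iter \<Psi> \<gamma> g)"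
proof -
  have "\<not> (\<forall>\<gamma>. \<delta> \<le> \<gamma>)"
    using assms by (auto simp: is_successor_def not_le)
  then show ?thesis
    using assms by (subst lower_iter.simps) (auto simp: the_is_successor)
qed

lemma lower_iter_limit:
  assumes "\<gamma> < \<delta>" and "\<And>\<gamma>. \<not> is_successor \<gamma> \<delta>"
  shows "lower_iter \<Psi> \<delta> g = (\<Sqinter>\<gamma>\<in>{..<\<delta>}. lower_iter \<Psi> \<gamma> g)"
proof -
  have "\<not> (\<forall>\<gamma>. \<delta> \<le> \<gamma>)"
    using assms(1) by (auto simp: not_le)
  then show ?thesis
    using assms(2) by (subst lower_iter.simps) auto
qed

end

theory Submission
  imports Defs
begin

text \<open>
  The lower iteration of a monotone operator from a point it decreases is itself decreasing. Its
  indices outnumber the lattice, so it takes the same value \<open>u\<close> at two indices, hence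
  \<open>u = \<Phi> u \<sqinter> f\<close>. Then \<open>u \<le> \<Phi> u\<close>, so \<open>u \<le> gfp \<Phi> = lfp \<Phi>\<close> by coinduction, and
  \<open>\<Phi> u \<le> lfp \<Phi> \<le> f\<close>.
\<close>

text \<open>A well-order may have a greatest element; \<delta> witnesses that something lies above
  \<gamma>, so the least such element exists.\<close>

lemma is_successor_exists:
  fixes \<gamma> \<delta> :: "'i::wellorder"
  assumes "\<gamma> < \<delta>"
  obtains \<eta> where "is_successor \<gamma> \<eta>" and "\<eta> \<le> \<delta>"
proof
  show "is_successor \<gamma> (LEAST \<eta>. \<gamma> < \<eta>)"
    unfolding is_successor_def using assms by (auto intro: LeastI Least_le)
  show "(LEAST \<eta>. \<gamma> < \<eta>) \<le> \<delta>"
    using assms by (rule Least_le)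
qed

text \<open>Mirrors the three branches of \<open>lower_iter\<close>, with each case in the form of
  the premises of the matching unfolding lemma.\<close>

lemma wellorder_cases [case_names zero successor limit]:
  fixes \<delta> :: "'i::wellorder"
  obtains "\<And>\<gamma>. \<delta> \<le> \<gamma>"
    | \<gamma> where "is_successor \<gamma> \<delta>"
    | \<gamma> where "\<gamma> < \<delta>" and "\<And>\<gamma>. \<not> is_successor \<gamma> \<delta>"
  by (meson not_le)

text \<open>Monotonicity carries the inequality through successors. At a limit, \<Psi> of the meet
  lies below \<Psi> of every earlier iterate, hence below that iterate by induction.\<close>

lemma lower_iter_step_le:
  assumes "mono \<Psi>" and "\<Psi> g \<le> g"
  shows "\<Psi> (lower_iter \<Psi> \<delta> g) \<le> lower_iter \<Psi> \<delta> g"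
proof (induction \<delta> rule: less_induct)
  case (less \<delta>)
  show ?case
  proof (cases \<delta> rule: wellorder_cases)
    case zero
    then show ?thesis
      using assms(2) by (simp add: lower_iter_zero)
  next
    case (successor \<gamma>)
    then show ?thesis
      using less[of \<gamma>] assms(1) by (simp add: lower_iter_successor is_successor_less monoD)
  next
    case (limit \<gamma>)
    have "\<Psi> (\<Sqinter>\<gamma>\<in>{..<\<delta>}. lower_iter \<Psi> \<gamma> g) \<le> lower_iter \<Psi> \<eta> g" if "\<eta> < \<delta>" for \<eta>
      using less[OF that] that by (meson INF_lower assms(1) lessThan_iff monoD order_trans)
    then show ?thesis
      unfolding lower_iter_limit[OF limit] by (auto intro: INF_greatest)
  qed
qed

lemma lower_iter_antimono:
  assumes "mono \<Psi>" and "\<Psi> g \<le> g" and "\<gamma> \<le> \<delta>"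
  shows "lower_iter \<Psi> \<delta> g \<le> lower_iter \<Psi> \<gamma> g"
  using assms(3)
proof (induction \<delta> rule: less_induct)
  case (less \<delta>)
  show ?case
  proof (cases "\<gamma> = \<delta>")
    case False
    with less.prems have "\<gamma> < \<delta>" by simp
    show ?thesis
    proof (cases \<delta> rule: wellorder_cases)
      case zero
      with \<open>\<gamma> < \<delta>\<close> show ?thesis by (meson leD)
    next
      case (successor \<eta>)
      \<comment> \<open>If \<eta> < \<gamma>, then \<delta>, as the successor of \<eta>, would be at
        most \<gamma>.\<close>
      then have "\<eta> < \<delta>" "\<gamma> \<le> \<eta>"
        using \<open>\<gamma> < \<delta>\<close> by (auto simp: is_successor_def not_le[symmetric])
      with less.IH have "lower_iter \<Psi> \<eta> g \<le> lower_iter \<Psi> \<gamma> g" by blast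
      with lower_iter_step_le[OF assms(1,2), of \<eta>] show ?thesis
        unfolding lower_iter_successor[OF successor] by (rule order_trans)
    next
      case (limit \<eta>)
      show ?thesis
        unfolding lower_iter_limit[OF limit] using \<open>\<gamma> < \<delta>\<close> by (auto intro: INF_lower)
    qed
  qed simp
qed

lemma lower_iter_fixed_point:
  fixes \<Psi> :: "'a::complete_lattice \<Rightarrow> 'a"
  assumes "mono \<Psi>" and "\<Psi> g \<le> g"
  obtains \<delta> :: "'a suc" where "\<Psi> (lower_iter \<Psi> \<delta> g) = lower_iter \<Psi> \<delta> g"
proof -
  \<comment> \<open>An injection would bound the cardinality of \<open>'a suc\<close> by that of
    \<open>'a\<close>.\<close>
  have "\<not> inj (\<lambda>\<delta> :: 'a suc. lower_iter \<Psi> \<delta> g)"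
    using card_of_UNIV_less_suc[where 'a = 'a] card_of_ordLeq not_ordLess_ordLeq
    by (metis subset_UNIV)
  then obtain \<gamma> \<delta> :: "'a suc" where "\<gamma> < \<delta>" and eq: "lower_iter \<Psi> \<gamma> g = lower_iter \<Psi> \<delta> g"
    unfolding inj_def by (metis linorder_neqE)
  from \<open>\<gamma> < \<delta>\<close> obtain \<eta> where "is_successor \<gamma> \<eta>" and "\<eta> \<le> \<delta>"
    by (rule is_successor_exists)
  \<comment> \<open>The indices \<gamma> and \<delta> need not be adjacent, but the successor \<eta>
    of \<gamma> lies between them, so its value is squeezed between two equal ones.\<close>
  with lower_iter_antimono[OF assms \<open>\<eta> \<le> \<delta>\<close>]
  have "lower_iter \<Psi> \<gamma> g \<le> \<Psi> (lower_iter \<Psi> \<gamma> g)"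
    by (simp add: eq lower_iter_successor)
  with lower_iter_step_le[OF assms, of \<gamma>] show ?thesis
    by (intro that antisym)
qed

lemma mono_kappa_op: "mono \<Phi> \<Longrightarrow> mono (kappa_op \<Phi> f)"
  unfolding kappa_op_def by (intro monoI inf_mono) (auto dest: monoD)

theorem theorem3:
  fixes \<Phi> :: "'a::complete_lattice \<Rightarrow> 'a"
  assumes "mono \<Phi>"
    and "lfp \<Phi> = gfp \<Phi>"
  shows "\<forall>f. lfp \<Phi> \<le> f \<longrightarrow> (\<exists>l :: 'a suc. \<Phi> (lower_iter (kappa_op \<Phi> f) l f) \<le> f)"
proof (intro allI impI)
  fix f
  assume "lfp \<Phi> \<le> f"
  \<comment> \<open>The meet with \<open>f\<close> is what makes the iteration from \<open>f\<close>
    start downwards.\<close>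
  have "kappa_op \<Phi> f f \<le> f"
    by (simp add: kappa_op_def)
  with mono_kappa_op[OF assms(1)] obtain l :: "'a suc"
    where "kappa_op \<Phi> f (lower_iter (kappa_op \<Phi> f) l f) = lower_iter (kappa_op \<Phi> f) l f"
    by (rule lower_iter_fixed_point)
  then have "lower_iter (kappa_op \<Phi> f) l f \<le> \<Phi> (lower_iter (kappa_op \<Phi> f) l f)"
    unfolding kappa_op_def by (metis inf_le1)
  then have "lower_iter (kappa_op \<Phi> f) l f \<le> lfp \<Phi>"
    unfolding assms(2) by (rule gfp_upperbound)
  \<comment> \<open>The extra application of \<Phi> is harmless because \<open>lfp \<Phi>\<close> is
    a fixed point.\<close>
  with assms(1) have "\<Phi> (lower_iter (kappa_op \<Phi> f) l f) \<le> \<Phi> (lfp \<Phi>)"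
    by (rule monoD)
  also have "\<dots> = lfp \<Phi>"
    using lfp_unfold[OF assms(1)] by simp
  also note \<open>lfp \<Phi> \<le> f\<close>
  finally show "\<exists>l :: 'a suc. \<Phi> (lower_iter (kappa_op \<Phi> f) l f) \<le> f" ..
qed

end
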